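(* If $\mathfrak{g}$ is a real nilpotent $7$-dimensional Lie algebra admitting a nice basis, then every Einstein metric on $\mathfrak{g}$ is Ricci-flat.
   Context: A basis $\{e_1,\dots,e_n\}$ of a nilpotent Lie algebra, with structure constants $a^k_{ij}$ given by $[e_i,e_j]=\sum_k a_{ij}^k e_k$, is called nice if: (1) for all $i<j$ there is at most one $k$ such that $a^k_{ij}\neq0$; (2) if $a^k_{ij}$ and $a^k_{lm}$ are nonzero then either $\{i,j\}=\{l,m\}$ or $\{i,j\}\cap\{l,m\}=\emptyset$. A metric on a real Lie algebra $\mathfrak{g}$ is a non-degenerate symmetric bilinear form on $\mathfrak{g}$ of arbitrary signature (not required to be related to the nice basis); it is identified with the left-invariant pseudoriemannian metric it defines on a Lie group with Lie algebra $\mathfrak{g}$, and its Ricci operator $\operatorname{ric}\colon\mathfrak{g}\to\mathfrak{g}$ is that of this left-invariant metric. The metric is Einstein if $\operatorname{ric}=\lambda\,\mathrm{Id}$ for some $\lambda\in\mathbb{R}$, and Ricci-flat if $\operatorname{ric}=0$. *)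

theory Defs
  imports "HOL-Analysis.Analysis"
begin

definition lie_bracket :: "('a::real_vector \<Rightarrow> 'a \<Rightarrow> 'a) \<Rightarrow> bool" where
  "lie_bracket br \<longleftrightarrow> bilinear br \<and> (\<forall>x. br x x = 0) \<and>
     (\<forall>x y z. br x (br y z) + br y (br z x) + br z (br x y) = 0)"

primrec lower_central :: "('a::real_vector \<Rightarrow> 'a \<Rightarrow> 'a) \<Rightarrow> nat \<Rightarrow> 'a set" where
  "lower_central br 0 = UNIV"
| "lower_central br (Suc k) = span {br x y | x y. y \<in> lower_central br k}"

definition nilpotent_bracket :: "('a::real_vector \<Rightarrow> 'a \<Rightarrow> 'a) \<Rightarrow> bool" where
  "nilpotent_bracket br \<longleftrightarrow> (\<exists>k. lower_central br k = {0})"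

text \<open>Bases are families \<open>e 1, \<dots>, e n\<close>; the values of \<open>e\<close> outside \<open>{1..n}\<close> are irrelevant.\<close>

definition basis_family :: "nat \<Rightarrow> (nat \<Rightarrow> 'a::real_vector) \<Rightarrow> bool" where
  "basis_family n e \<longleftrightarrow>
     inj_on e {1..n} \<and> independent (e ` {1..n}) \<and> span (e ` {1..n}) = UNIV"

text \<open>\<open>structure_const br n e i j k\<close> is the coefficient of \<open>e k\<close> in \<open>br (e i) (e j)\<close>.\<close>

definition structure_const ::
  "('a::real_vector \<Rightarrow> 'a \<Rightarrow> 'a) \<Rightarrow> nat \<Rightarrow> (nat \<Rightarrow> 'a) \<Rightarrow> nat \<Rightarrow> nat \<Rightarrow> nat \<Rightarrow> real" where
  "structure_const br n e i j k =
     real_vector.representation (e ` {1..n}) (br (e i) (e j)) (e k)"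

definition nice_basis :: "('a::real_vector \<Rightarrow> 'a \<Rightarrow> 'a) \<Rightarrow> nat \<Rightarrow> (nat \<Rightarrow> 'a) \<Rightarrow> bool" where
  "nice_basis br n e \<longleftrightarrow> basis_family n e \<and>
     (\<forall>i\<in>{1..n}. \<forall>j\<in>{1..n}. i < j \<longrightarrow>
        (\<forall>k\<in>{1..n}. \<forall>k'\<in>{1..n}.
           structure_const br n e i j k \<noteq> 0 \<and> structure_const br n e i j k' \<noteq> 0 \<longrightarrow> k = k')) \<and>
     (\<forall>i\<in>{1..n}. \<forall>j\<in>{1..n}. \<forall>l\<in>{1..n}. \<forall>m\<in>{1..n}. \<forall>k\<in>{1..n}.
        structure_const br n e i j k \<noteq> 0 \<and> structure_const br n e l m k \<noteq> 0 \<longrightarrow>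
        {i, j} = {l, m} \<or> {i, j} \<inter> {l, m} = {})"

definition pseudo_metric :: "('a::real_vector \<Rightarrow> 'a \<Rightarrow> real) \<Rightarrow> bool" where
  "pseudo_metric g \<longleftrightarrow> bilinear g \<and> (\<forall>x y. g x y = g y x) \<and>
     (\<forall>x. (\<forall>y. g x y = 0) \<longrightarrow> x = 0)"

text \<open>
  A left-invariant connection is determined by its values on left-invariant vector fields,
  i.e. by a bilinear map on the Lie algebra. In the condition of compatibility with the metric
  the derivatives of \<open>g y z\<close> vanish, since \<open>g y z\<close> is constant for left-invariant \<open>y\<close>, \<open>z\<close>.
\<close>

definition is_levi_civita ::
  "('a::real_vector \<Rightarrow> 'a \<Rightarrow> 'a) \<Rightarrow> ('a \<Rightarrow> 'a \<Rightarrow> real) \<Rightarrow> ('a \<Rightarrow> 'a \<Rightarrow> 'a) \<Rightarrow> bool" where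
  "is_levi_civita br g D \<longleftrightarrow> bilinear D \<and>
     (\<forall>x y. D x y - D y x = br x y) \<and>
     (\<forall>x y z. g (D x y) z + g y (D x z) = 0)"

text \<open>Existence and uniqueness in finite dimension are proved at the end of the theory.\<close>

definition levi_civita ::
  "('a::real_vector \<Rightarrow> 'a \<Rightarrow> 'a) \<Rightarrow> ('a \<Rightarrow> 'a \<Rightarrow> real) \<Rightarrow> 'a \<Rightarrow> 'a \<Rightarrow> 'a" where
  "levi_civita br g = (THE D. is_levi_civita br g D)"

definition curvature ::
  "('a::real_vector \<Rightarrow> 'a \<Rightarrow> 'a) \<Rightarrow> ('a \<Rightarrow> 'a \<Rightarrow> real) \<Rightarrow> 'a \<Rightarrow> 'a \<Rightarrow> 'a \<Rightarrow> 'a" where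
  "curvature br g x y z =
     (let D = levi_civita br g in D x (D y z) - D y (D x z) - D (br x y) z)"

text \<open>
  The trace of an endomorphism of a finite-dimensional space, computed in an arbitrarily chosen
  basis; it does not depend on the choice, see \<open>lin_trace_eq\<close> below.
\<close>

definition lin_trace :: "('a::real_vector \<Rightarrow> 'a) \<Rightarrow> real" where
  "lin_trace f =
     (let B = real_vector.extend_basis {} in \<Sum>b\<in>B. real_vector.representation B (f b) b)"

definition ricci_tensor ::
  "('a::real_vector \<Rightarrow> 'a \<Rightarrow> 'a) \<Rightarrow> ('a \<Rightarrow> 'a \<Rightarrow> real) \<Rightarrow> 'a \<Rightarrow> 'a \<Rightarrow> real" where
  "ricci_tensor br g x y = lin_trace (\<lambda>z. curvature br g z x y)"

definition ricci_operator ::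
  "('a::real_vector \<Rightarrow> 'a \<Rightarrow> 'a) \<Rightarrow> ('a \<Rightarrow> 'a \<Rightarrow> real) \<Rightarrow> 'a \<Rightarrow> 'a" where
  "ricci_operator br g x = (THE v. \<forall>y. g v y = ricci_tensor br g x y)"

definition einstein :: "('a::real_vector \<Rightarrow> 'a \<Rightarrow> 'a) \<Rightarrow> ('a \<Rightarrow> 'a \<Rightarrow> real) \<Rightarrow> bool" where
  "einstein br g \<longleftrightarrow> (\<exists>c::real. \<forall>x. ricci_operator br g x = c *\<^sub>R x)"

definition ricci_flat :: "('a::real_vector \<Rightarrow> 'a \<Rightarrow> 'a) \<Rightarrow> ('a \<Rightarrow> 'a \<Rightarrow> real) \<Rightarrow> bool" where
  "ricci_flat br g \<longleftrightarrow> (\<forall>x. ricci_operator br g x = 0)"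


subsection \<open>The definitions above are meaningful in finite dimension\<close>

lemma lin_trace_eq:
  fixes f :: "'a::real_vector \<Rightarrow> 'a"
  assumes f: "linear f" and B: "finite B" "independent B" "span B = UNIV"
  shows "lin_trace f = (\<Sum>b\<in>B. real_vector.representation B (f b) b)"
proof -
  interpret finite_dimensional_vector_space "scaleR :: real \<Rightarrow> 'a \<Rightarrow> 'a" B
    by unfold_locales (use B in \<open>auto simp: dependent_raw_def span_raw_def\<close>)
  let ?R = "real_vector.representation"
  define C where "C = real_vector.extend_basis ({} :: 'a set)"
  have C: "independent C" "span C = UNIV"
    using real_vector.independent_extend_basis[OF real_vector.independent_empty]
      real_vector.span_extend_basis[OF real_vector.independent_empty] by (auto simp: C_def)
  have fC: "finite C"
    using finiteI_independent C(1) by (simp add: dependent_raw_def)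
  have lin: "linear (\<lambda>v. ?R A v b)" if "independent A" "span A = UNIV" for A and b :: 'a
    using real_vector.linear_representation[OF that] by (simp add: linear_def real_scaleR_def[abs_def])
  have expand: "?R A (f v) a = (\<Sum>d\<in>D. ?R D v d * ?R A (f d) a)"
    if A: "independent A" "span A = UNIV" and D: "independent D" "span D = UNIV" "finite D"
    for A D and v a :: 'a
  proof -
    have "linear (\<lambda>v. ?R A (f v) a)"
      using linear_compose[OF f lin[OF A]] by (simp add: o_def)
    then have "?R A (f (\<Sum>d\<in>D. ?R D v d *\<^sub>R d)) a = (\<Sum>d\<in>D. ?R D v d * ?R A (f d) a)"
      using linear_sum[of "\<lambda>v. ?R A (f v) a" "\<lambda>d. ?R D v d *\<^sub>R d" D]
        linear_cmul[of "\<lambda>v. ?R A (f v) a"] by simp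
    moreover have "(\<Sum>d\<in>D. ?R D v d *\<^sub>R d) = v"
      by (rule real_vector.sum_representation_eq) (use D in auto)
    ultimately show ?thesis by simp
  qed
  have change: "?R A w a = (\<Sum>d\<in>D. ?R D w d * ?R A d a)"
    if A: "independent A" "span A = UNIV" and D: "independent D" "span D = UNIV" "finite D"
    for A D and w a :: 'a
  proof -
    have "?R A (\<Sum>d\<in>D. ?R D w d *\<^sub>R d) a = (\<Sum>d\<in>D. ?R D w d * ?R A d a)"
      using linear_sum[OF lin[OF A], of "\<lambda>d. ?R D w d *\<^sub>R d" D] linear_cmul[OF lin[OF A]] by simp
    moreover have "(\<Sum>d\<in>D. ?R D w d *\<^sub>R d) = w"
      by (rule real_vector.sum_representation_eq) (use D in auto)
    ultimately show ?thesis by simp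
  qed
  have "(\<Sum>b\<in>B. ?R B (f b) b) = (\<Sum>b\<in>B. \<Sum>c\<in>C. ?R C b c * ?R B (f c) b)"
    by (intro sum.cong refl expand B C fC)
  also have "\<dots> = (\<Sum>c\<in>C. \<Sum>b\<in>B. ?R B (f c) b * ?R C b c)"
    by (subst sum.swap) (simp add: mult.commute)
  also have "\<dots> = (\<Sum>c\<in>C. ?R C (f c) c)"
    by (intro sum.cong refl change[symmetric] B C fC)
  finally show ?thesis
    by (simp add: lin_trace_def C_def Let_def)
qed

lemma pseudo_metric_eqI:
  assumes g: "pseudo_metric g" and eq: "\<And>z. g u z = g v z"
  shows "u = v"
proof -
  have "g (u - v) z = 0" for z
    using g eq[of z] bilinear_lsub[of g u v z] by (simp add: pseudo_metric_def)
  then show ?thesis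
    using g unfolding pseudo_metric_def by (metis right_minus_eq)
qed

lemma pseudo_metric_represents:
  fixes g :: "'a::real_vector \<Rightarrow> 'a \<Rightarrow> real"
  assumes g: "pseudo_metric g" and B: "finite B" "span B = (UNIV :: 'a set)" and f: "linear f"
  shows "\<exists>!v. \<forall>z. g v z = f z"
proof -
  obtain C where C: "C \<subseteq> B" "independent C" "span C = UNIV"
    using real_vector.maximal_independent_subset[of B] B(2)
    by (metis real_vector.span_span real_vector.span_mono top.extremum_uniqueI)
  have fC: "finite C" using C(1) B(1) finite_subset by blast
  interpret finite_dimensional_vector_space "scaleR :: real \<Rightarrow> 'a \<Rightarrow> 'a" C
    by unfold_locales (use C fC in \<open>auto simp: dependent_raw_def span_raw_def\<close>)
  have bl: "bilinear g" using g by (simp add: pseudo_metric_def)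
  have lin: "linear (\<lambda>x. g x z)" "linear (g x)" for x z
    using bl by (simp_all add: bilinear_def)
  define h where "h x = (\<Sum>c\<in>C. g x c *\<^sub>R c)" for x
  have h: "linear h"
    unfolding h_def
    by (intro linearI) (simp_all add: bilinear_ladd[OF bl] bilinear_lmul[OF bl] scaleR_add_left
        sum.distrib scaleR_sum_right)
  have eqC: "k = l" if "linear k" "linear l" "\<And>c. c \<in> C \<Longrightarrow> k c = l c" for k l :: "'a \<Rightarrow> real"
    using real_vector.linear_eq_on_span[of k l C] that C(3) by blast
  have coeff: "u c = v c" if "(\<Sum>c\<in>C. u c *\<^sub>R c) = (\<Sum>c\<in>C. v c *\<^sub>R c)" "c \<in> C"
    for u v :: "'a \<Rightarrow> real" and c
  proof -
    have "(\<Sum>c\<in>C. (u c - v c) *\<^sub>R c) = 0"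
      using that(1) by (simp add: scaleR_diff_left sum_subtractf)
    then show ?thesis
      using real_vector.independentD[OF C(2) fC order_refl _ that(2), of "\<lambda>c. u c - v c"] by simp
  qed
  have "inj h"
  proof
    fix x y assume "h x = h y"
    then have "g x c = g y c" if "c \<in> C" for c
      using coeff[of "g x" "g y" c] that by (simp add: h_def)
    then have "g x = g y" by (rule eqC[OF lin(2) lin(2)])
    then show "x = y" using pseudo_metric_eqI[OF g] by metis
  qed
  moreover have "Vector_Spaces.linear scaleR scaleR h" using h by (simp add: linear_def)
  ultimately have "surj h" using linear_inj_imp_surj by blast
  then obtain v where v: "h v = (\<Sum>c\<in>C. f c *\<^sub>R c)" by (metis surjD)
  then have "g v c = f c" if "c \<in> C" for c
    using coeff[of "g v" f c] that by (simp add: h_def)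
  then have "g v = f" by (rule eqC[OF lin(2) f])
  then show ?thesis using pseudo_metric_eqI[OF g] by metis
qed

lemma levi_civita_koszul:
  assumes br: "lie_bracket br" and g: "pseudo_metric g" and D: "is_levi_civita br g D"
  shows "2 * g (D x y) z = g (br x y) z - g (br y z) x + g (br z x) y"
proof -
  have bl: "bilinear g" and sym: "\<And>x y. g x y = g y x"
    using g by (auto simp: pseudo_metric_def)
  have t: "br u v = D u v - D v u" for u v using D by (simp add: is_levi_civita_def)
  have m: "g (D u v) w + g v (D u w) = 0" for u v w using D by (simp add: is_levi_civita_def)
  show ?thesis
    using m[of x y z] m[of y z x] m[of z x y]
    by (simp add: t bilinear_lsub[OF bl] sym[of y] sym[of z] sym[of x])
qed

lemma ex1_levi_civita:
  fixes br :: "'a::real_vector \<Rightarrow> 'a \<Rightarrow> 'a"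
  assumes br: "lie_bracket br" and g: "pseudo_metric g" and B: "finite B" "span B = (UNIV :: 'a set)"
  shows "\<exists>!D. is_levi_civita br g D"
proof -
  have bl: "bilinear g" and sym: "\<And>x y. g x y = g y x"
    using g by (auto simp: pseudo_metric_def)
  have bb: "bilinear br" and alt: "\<And>x. br x x = 0" using br by (auto simp: lie_bracket_def)
  have skew: "br x y = - br y x" for x y
    using alt[of "x + y"] alt[of x] alt[of y]
    by (simp add: bilinear_ladd[OF bb] bilinear_radd[OF bb] add_eq_0_iff)
  define K where "K x y z = (g (br x y) z - g (br y z) x + g (br z x) y) / 2" for x y z
  note lins = bilinear_ladd[OF bl] bilinear_radd[OF bl] bilinear_lmul[OF bl] bilinear_rmul[OF bl]
    bilinear_ladd[OF bb] bilinear_radd[OF bb] bilinear_lmul[OF bb] bilinear_rmul[OF bb]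
  have "linear (K x y)" for x y
    by (rule linearI) (simp_all add: K_def lins field_simps)
  then have "\<exists>v. \<forall>z. g v z = K x y z" for x y
    using pseudo_metric_represents[OF g B] by blast
  then obtain D where D: "\<And>x y z. g (D x y) z = K x y z" by metis
  have "bilinear D"
    unfolding bilinear_def
    by (intro conjI allI linearI; rule pseudo_metric_eqI[OF g])
       (simp_all add: D lins K_def field_simps)
  moreover have "D x y - D y x = br x y" for x y
  proof (rule pseudo_metric_eqI[OF g])
    fix z show "g (D x y - D y x) z = g (br x y) z"
      by (simp add: D bilinear_lsub[OF bl] K_def skew[of y x] skew[of z] bilinear_lneg[OF bl]
          field_simps)
  qed
  moreover have "g (D x y) z + g y (D x z) = 0" for x y z
    by (simp add: D sym[of y "D x z"] K_def skew[of z] skew[of y x] bilinear_lneg[OF bl]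
        field_simps)
  ultimately have LC: "is_levi_civita br g D" by (simp add: is_levi_civita_def)
  have "D' = D" if D': "is_levi_civita br g D'" for D'
  proof (intro ext)
    fix x y
    show "D' x y = D x y"
      using levi_civita_koszul[OF br g D', of x y] levi_civita_koszul[OF br g LC, of x y]
      by (intro pseudo_metric_eqI[OF g]) (metis mult_cancel_left zero_neq_numeral)
  qed
  with LC show ?thesis by blast
qed

lemma ricci_operator_spec:
  fixes br :: "'a::real_vector \<Rightarrow> 'a \<Rightarrow> 'a"
  assumes br: "lie_bracket br" and g: "pseudo_metric g" and B: "finite B" "span B = (UNIV :: 'a set)"
  shows "g (ricci_operator br g x) y = ricci_tensor br g x y"
proof -
  have "is_levi_civita br g (levi_civita br g)"
    unfolding levi_civita_def by (rule theI'[OF ex1_levi_civita[OF br g B]])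
  then have bD: "bilinear (levi_civita br g)" by (simp add: is_levi_civita_def)
  note lins = bilinear_ladd[OF bD] bilinear_radd[OF bD] bilinear_lmul[OF bD] bilinear_rmul[OF bD]
  define C where "C = real_vector.extend_basis ({} :: 'a set)"
  have C: "independent C" "span C = UNIV"
    using real_vector.independent_extend_basis[OF real_vector.independent_empty]
      real_vector.span_extend_basis[OF real_vector.independent_empty] by (auto simp: C_def)
  have cadd: "curvature br g z x (u + v) = curvature br g z x u + curvature br g z x v" for u v z
    by (simp add: curvature_def Let_def lins algebra_simps)
  have cmul: "curvature br g z x (c *\<^sub>R u) = c *\<^sub>R curvature br g z x u" for c u z
    by (simp add: curvature_def Let_def lins algebra_simps)
  have "linear (ricci_tensor br g x)"
    by (rule linearI)
       (simp_all add: ricci_tensor_def lin_trace_def Let_def C_def[symmetric] cadd cmul C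
          real_vector.representation_add real_vector.representation_scale sum.distrib sum_distrib_left)
  from theI'[OF pseudo_metric_represents[OF g B this]] show ?thesis
    by (simp add: ricci_operator_def)
qed

end

(*
  Write T_x z = D_z x for the Levi-Civita connection D. On a unimodular Lie algebra
  Ric(x, y) = - tr (T_x T_y), and if moreover the Killing form vanishes, the Koszul formula gives
    4 Ric(x, y) = - 2 sum_i g([x, e_i], [y, f_i]) + sum_ij g([e_i, f_j], x) g([f_i, e_j], y)
  for g-dual bases e, f. Evaluating sum_k Ric(d e_k, f_k) for a derivation d, the two terms cancel;
  so if Ric = c g then c tr d = 0, and it suffices to find a derivation with nonzero trace.

  For a nice basis, weights u_i with u_i + u_j = u_k whenever [e_i, e_j] is a nonzero multiple
  of e_k define a diagonal derivation of trace sum_i u_i. Order the basis along the lower central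
  series, so that i, j < k whenever [e_i, e_j] is a nonzero multiple of e_k. What remains is
  a statement about 35 Booleans: for every set of triples i < j < k in {0, ..., 6} which satisfies
  the two axioms of a nice basis and in which no term of a Jacobi identity stands alone, one of
  the vectors of an explicit list is such a weight with nonzero sum.
*)
theory Submission
  imports Defs
begin

subsection \<open>The Ricci tensor and derivations\<close>

lemma lie_bracket_skew: "lie_bracket br \<Longrightarrow> br x y = - br y x"
proof -
  assume "lie_bracket br"
  then have bilin: "bilinear br" and alt: "\<And>x. br x x = 0"
    by (auto simp: lie_bracket_def)
  show ?thesis
    using alt[of "x + y"] alt[of x] alt[of y]
    by (simp add: bilinear_ladd[OF bilin] bilinear_radd[OF bilin] add_eq_0_iff)
qed

text \<open>The metric may be indefinite, so a pair of families replaces an orthonormal basis.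
  Duality of \<open>e\<close> and \<open>f\<close> enters through the expansion formula.\<close>

locale dual_bases =
  fixes g :: "'a::real_vector \<Rightarrow> 'a \<Rightarrow> real" and e f :: "'i \<Rightarrow> 'a" and I :: "'i set"
  assumes metric: "pseudo_metric g"
    and expand: "x = (\<Sum>i\<in>I. g x (f i) *\<^sub>R e i)"
begin

lemma bilin: "bilinear g" and sym: "g x y = g y x"
  using metric by (auto simp: pseudo_metric_def)

lemmas g_simps = bilinear_ladd[OF bilin] bilinear_radd[OF bilin] bilinear_lmul[OF bilin]
  bilinear_rmul[OF bilin] bilinear_lsub[OF bilin] bilinear_rsub[OF bilin]
  bilinear_lneg[OF bilin] bilinear_rneg[OF bilin]

lemma g_sum_left: "g (\<Sum>i\<in>A. h i) y = (\<Sum>i\<in>A. g (h i) y)"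
  using bilin linear_sum[of "\<lambda>x. g x y"] by (simp add: bilinear_def)

lemma parseval: "(\<Sum>i\<in>I. g x (f i) * g (e i) y) = g x y"
  using arg_cong[OF expand[of x], of "\<lambda>u. g u y"] by (simp add: g_sum_left g_simps)

lemma expand': "x = (\<Sum>i\<in>I. g x (e i) *\<^sub>R f i)"
proof (rule pseudo_metric_eqI[OF metric])
  fix z
  show "g x z = g (\<Sum>i\<in>I. g x (e i) *\<^sub>R f i) z"
    using parseval[of z x] by (simp add: g_sum_left g_simps sym[of z] sym[of _ x] mult.commute)
qed

lemma parseval': "(\<Sum>i\<in>I. g x (e i) * g (f i) y) = g x y"
  using arg_cong[OF expand'[of x], of "\<lambda>u. g u y"] by (simp add: g_sum_left g_simps)

text \<open>Expanding \<open>f i\<close> in the family \<open>e\<close> gives the coefficients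
  \<open>g (f i) (f j)\<close>, which are symmetric in \<open>i\<close> and \<open>j\<close>. This
  allows \<open>e\<close> and \<open>f\<close> to be exchanged under a trace.\<close>

lemma swap:
  assumes "\<And>x. linear (h x)" "\<And>y. linear (\<lambda>x. h x y :: real)"
  shows "(\<Sum>i\<in>I. h (e i) (f i)) = (\<Sum>i\<in>I. h (f i) (e i))"
proof -
  have "(\<Sum>i\<in>I. h (e i) (f i)) = (\<Sum>i\<in>I. h (e i) (\<Sum>j\<in>I. g (f i) (f j) *\<^sub>R e j))"
    by (simp flip: expand)
  also have "\<dots> = (\<Sum>i\<in>I. \<Sum>j\<in>I. g (f i) (f j) * h (e i) (e j))"
    by (simp add: linear_sum[OF assms(1)] linear_cmul[OF assms(1)])
  also have "\<dots> = (\<Sum>j\<in>I. \<Sum>i\<in>I. g (f j) (f i) * h (e i) (e j))"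
    by (subst sum.swap) (simp add: sym)
  also have "\<dots> = (\<Sum>j\<in>I. h (\<Sum>i\<in>I. g (f j) (f i) *\<^sub>R e i) (e j))"
    by (simp add: linear_sum[OF assms(2)] linear_cmul[OF assms(2)])
  also have "\<dots> = (\<Sum>i\<in>I. h (f i) (e i))"
    by (simp flip: expand)
  finally show ?thesis .
qed

lemma swap2:
  assumes "\<And>x y z. linear (\<lambda>u. h u x y z)" "\<And>x y z. linear (\<lambda>u. h x u y z)"
    "\<And>x y z. linear (\<lambda>u. h x y u z)" "\<And>x y z. linear (\<lambda>u. h x y z u :: real)"
  shows "(\<Sum>i\<in>I. \<Sum>j\<in>I. h (e i) (f i) (e j) (f j)) = (\<Sum>i\<in>I. \<Sum>j\<in>I. h (f i) (e i) (f j) (e j))"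
proof -
  have "(\<Sum>i\<in>I. \<Sum>j\<in>I. h (e i) (f i) (e j) (f j)) = (\<Sum>i\<in>I. \<Sum>j\<in>I. h (e i) (f i) (f j) (e j))"
    by (intro sum.cong refl swap assms)
  also have "\<dots> = (\<Sum>j\<in>I. \<Sum>i\<in>I. h (e i) (f i) (f j) (e j))"
    by (rule sum.swap)
  also have "\<dots> = (\<Sum>j\<in>I. \<Sum>i\<in>I. h (f i) (e i) (f j) (e j))"
    by (intro sum.cong refl swap assms)
  also have "\<dots> = (\<Sum>i\<in>I. \<Sum>j\<in>I. h (f i) (e i) (f j) (e j))"
    by (rule sum.swap)
  finally show ?thesis .
qed

definition tr :: "('a \<Rightarrow> 'a) \<Rightarrow> real" where
  "tr A = (\<Sum>i\<in>I. g (A (e i)) (f i))"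

lemma tr_dual: "linear A \<Longrightarrow> tr A = (\<Sum>i\<in>I. g (A (f i)) (e i))"
  unfolding tr_def
  by (rule swap) (auto intro!: linearI simp: linear_add linear_cmul g_simps)

lemma tr_mult:
  assumes "linear A"
  shows "tr (\<lambda>x. A (B x)) = (\<Sum>i\<in>I. \<Sum>j\<in>I. g (B (e i)) (f j) * g (A (e j)) (f i))"
proof -
  have "A (B (e i)) = (\<Sum>j\<in>I. g (B (e i)) (f j) *\<^sub>R A (e j))" for i
    using arg_cong[OF expand[of "B (e i)"], of A]
    by (simp add: linear_sum[OF assms] linear_cmul[OF assms])
  then show ?thesis
    by (simp add: tr_def g_sum_left g_simps)
qed

lemma tr_commute:
  assumes "linear A" "linear B"
  shows "tr (\<lambda>x. A (B x)) = tr (\<lambda>x. B (A x))"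
  unfolding tr_mult[OF assms(1)] tr_mult[OF assms(2)]
  by (subst sum.swap) (simp add: mult.commute)

text \<open>Skewness turns each diagonal term into minus the term with \<open>e\<close> and
  \<open>f\<close> exchanged, and by \<open>tr_dual\<close> this exchange preserves the
  trace.\<close>

lemma tr_skew:
  assumes "linear A" "\<And>x y. g (A x) y + g x (A y) = 0"
  shows "tr A = 0"
proof -
  have "g (A (e i)) (f i) = - g (A (f i)) (e i)" for i
    using assms(2)[of "e i" "f i"] sym[of "e i"] by simp
  then have "tr A = - (\<Sum>i\<in>I. g (A (f i)) (e i))"
    by (simp add: tr_def sum_negf)
  then show ?thesis
    using tr_dual[OF assms(1)] by simp
qed

section \<open>The Ricci tensor of a unimodular Lie algebra with zero Killing form\<close>

context
  fixes br :: "'a \<Rightarrow> 'a \<Rightarrow> 'a" and D :: "'a \<Rightarrow> 'a \<Rightarrow> 'a"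
  assumes lie: "lie_bracket br"
    and unimod: "\<And>x. tr (br x) = 0"
    and killing: "\<And>x y. tr (\<lambda>z. br x (br y z)) = 0"
    and LC: "is_levi_civita br g D"
begin

lemma br_bilin: "bilinear br"
  using lie by (auto simp: lie_bracket_def)

lemma D_bilin: "bilinear D" and torsion: "D x y - D y x = br x y"
  and compat: "g (D x y) z + g y (D x z) = 0"
  using LC by (auto simp: is_levi_civita_def)

lemmas br_simps = bilinear_ladd[OF br_bilin] bilinear_radd[OF br_bilin] bilinear_lmul[OF br_bilin]
  bilinear_rmul[OF br_bilin] bilinear_lsub[OF br_bilin] bilinear_rsub[OF br_bilin]
  bilinear_lneg[OF br_bilin] bilinear_rneg[OF br_bilin]

lemmas D_simps = bilinear_ladd[OF D_bilin] bilinear_radd[OF D_bilin] bilinear_lmul[OF D_bilin]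
  bilinear_rmul[OF D_bilin] bilinear_lsub[OF D_bilin] bilinear_rsub[OF D_bilin]

lemmas br_skew = lie_bracket_skew[OF lie]

lemma lin: "linear (br x)" "linear (\<lambda>x. br x y)" "linear (D x)" "linear (\<lambda>x. D x y)"
  using br_bilin D_bilin by (auto simp: bilinear_def)

text \<open>The map is \<open>D v\<close> minus \<open>br v\<close>: the first is skew for
  \<open>g\<close>, the second traceless by unimodularity.\<close>

lemma tr_torsion: "tr (\<lambda>z. D z v) = 0"
proof -
  have "D z v = D v z - br v z" for z
    using torsion[of v z] by (simp add: algebra_simps)
  then have "tr (\<lambda>z. D z v) = tr (D v) - tr (br v)"
    by (simp add: tr_def g_simps sum_subtractf)
  then show ?thesis
    using tr_skew[OF lin(3) compat] unimod by simp
qed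

text \<open>The left-hand map is the curvature z -> R(z, x) y. Torsion-freeness splits its last term
  in two; one piece cancels the middle term by cyclicity of the trace, and the first term is
  traceless by \<open>tr_torsion\<close>.\<close>

lemma ricci_trace:
  "tr (\<lambda>z. D z (D x y) - D x (D z y) - D (br z x) y) = - tr (\<lambda>z. D (D z x) y)"
proof -
  have *: "D (br z x) y = D (D z x) y - D (D x z) y" for z
    by (simp add: torsion[symmetric] D_simps)
  have "tr (\<lambda>z. D z (D x y) - D x (D z y) - D (br z x) y)
      = tr (\<lambda>z. D z (D x y)) - tr (\<lambda>z. D x (D z y)) - tr (\<lambda>z. D (D z x) y)
        + tr (\<lambda>z. D (D x z) y)"
    by (simp add: * tr_def g_simps sum_subtractf sum.distrib algebra_simps)
  then show ?thesis
    using tr_torsion tr_commute[OF lin(3) lin(4)] by simp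
qed

text \<open>The Koszul formula splits \<open>2 * g (D z x) u\<close> into a part symmetric in
  \<open>z\<close>, \<open>u\<close> and a skew part. In the trace of the product the mixed terms
  vanish; the symmetric parts give the first sum, the skew parts the second.\<close>

lemma ricci_formula:
  "4 * tr (\<lambda>z. D (D z x) y) = 2 * (\<Sum>i\<in>I. g (br x (e i)) (br y (f i)))
    - (\<Sum>i\<in>I. \<Sum>j\<in>I. g (br (e i) (f j)) x * g (br (f i) (e j)) y)"
proof -
  define S where "S x z u = g (br x z) u + g (br x u) z" for x z u
  define N where "N x z u = g (br z u) x" for x z u
  have K: "2 * g (D z x) u = - S x z u - N x z u" for x z u
    using levi_civita_koszul[OF lie metric LC, of z x u] br_skew[of z x] br_skew[of u z]
    by (simp add: S_def N_def g_simps)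
  have linS: "linear (S x z)" "linear (\<lambda>z. S x z u)" and linN: "linear (N x z)" "linear (\<lambda>z. N x z u)"
    for x z u
    by (auto intro!: linearI simp: S_def N_def br_simps g_simps algebra_simps)
  have S_sym: "S x z u = S x u z" and N_skew: "N x z u = - N x u z" for x z u
    using br_skew[of z u] by (auto simp: S_def N_def g_simps)
  have "4 * tr (\<lambda>z. D (D z x) y) = (\<Sum>i\<in>I. \<Sum>j\<in>I. (2 * g (D (e i) x) (f j)) * (2 * g (D (e j) y) (f i)))"
    by (simp add: tr_mult[OF lin(4)] sum_distrib_left algebra_simps)
  also have "\<dots> = (\<Sum>i\<in>I. \<Sum>j\<in>I. S x (e i) (f j) * S y (e j) (f i))
      + (\<Sum>i\<in>I. \<Sum>j\<in>I. S x (e i) (f j) * N y (e j) (f i))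
      + (\<Sum>i\<in>I. \<Sum>j\<in>I. S y (e j) (f i) * N x (e i) (f j))
      + (\<Sum>i\<in>I. \<Sum>j\<in>I. N x (e i) (f j) * N y (e j) (f i))"
    by (simp add: K algebra_simps sum.distrib)
  \<comment> \<open>Exchanging \<open>e\<close> with \<open>f\<close> and relabelling sends this sum
    to its negative, as \<open>S\<close> is symmetric and \<open>N\<close> is skew.\<close>
  also have cross: "(\<Sum>i\<in>I. \<Sum>j\<in>I. S x (e i) (f j) * N y (e j) (f i)) = 0" for x y
  proof -
    have "(\<Sum>i\<in>I. \<Sum>j\<in>I. S x (e i) (f j) * N y (e j) (f i))
        = (\<Sum>i\<in>I. \<Sum>j\<in>I. S x (f i) (e j) * N y (f j) (e i))"
      by (rule swap2) (auto intro!: linearI simp: linS[THEN linear_add] linS[THEN linear_cmul]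
          linN[THEN linear_add] linN[THEN linear_cmul] algebra_simps)
    also have "\<dots> = (\<Sum>j\<in>I. \<Sum>i\<in>I. S x (f i) (e j) * N y (f j) (e i))"
      by (rule sum.swap)
    also have "\<dots> = - (\<Sum>i\<in>I. \<Sum>j\<in>I. S x (e i) (f j) * N y (e j) (f i))"
      by (simp add: S_sym[of x "f _"] N_skew[of y "f _"] sum_negf)
    finally show ?thesis by simp
  qed
  also have "(\<Sum>i\<in>I. \<Sum>j\<in>I. S y (e j) (f i) * N x (e i) (f j)) = 0"
    using cross[of y x] by (subst sum.swap)
  also have "(\<Sum>i\<in>I. \<Sum>j\<in>I. N x (e i) (f j) * N y (e j) (f i))
      = - (\<Sum>i\<in>I. \<Sum>j\<in>I. g (br (e i) (f j)) x * g (br (f i) (e j)) y)"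
    by (simp add: N_skew[of y "e _"] sum_negf) (simp add: N_def)
  also have "(\<Sum>i\<in>I. \<Sum>j\<in>I. S x (e i) (f j) * S y (e j) (f i))
      = 2 * (\<Sum>i\<in>I. g (br x (e i)) (br y (f i)))"
  proof -
    \<comment> \<open>The product of the \<open>S\<close> factors has four terms: \<open>1\<close>
      and \<open>2\<close> are values of the Killing form and vanish, the other two both contract to
      the sum in \<open>3\<close>.\<close>
    have 1: "(\<Sum>i\<in>I. \<Sum>j\<in>I. g (br x (e i)) (f j) * g (br y (e j)) (f i)) = 0"
      using killing[of y x] by (simp add: tr_mult[OF lin(1)])
    have 2: "(\<Sum>i\<in>I. \<Sum>j\<in>I. g (br x (f j)) (e i) * g (br y (f i)) (e j)) = 0"
    proof -
      have "(\<Sum>i\<in>I. \<Sum>j\<in>I. g (br x (f j)) (e i) * g (br y (f i)) (e j))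
          = (\<Sum>i\<in>I. \<Sum>j\<in>I. g (br x (e j)) (f i) * g (br y (e i)) (f j))"
        by (rule swap2) (auto intro!: linearI simp: br_simps g_simps algebra_simps)
      then show ?thesis using 1 by (subst (asm) (2) sum.swap) simp
    qed
    have 3: "(\<Sum>i\<in>I. \<Sum>j\<in>I. g (br x (e i)) (f j) * g (br y (f i)) (e j))
        = (\<Sum>i\<in>I. g (br x (e i)) (br y (f i)))"
      by (simp add: sym[of "br y _"] parseval)
    have "(\<Sum>i\<in>I. \<Sum>j\<in>I. g (br x (f j)) (e i) * g (br y (e j)) (f i))
        = (\<Sum>j\<in>I. \<Sum>i\<in>I. g (br x (f j)) (e i) * g (br y (e j)) (f i))"
      by (rule sum.swap)
    also have "\<dots> = (\<Sum>j\<in>I. g (br x (f j)) (br y (e j)))"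
      by (simp add: sym[of "br y _"] parseval')
    also have "\<dots> = (\<Sum>i\<in>I. g (br x (e i)) (br y (f i)))"
      by (rule swap[symmetric]) (auto intro!: linearI simp: br_simps g_simps)
    finally show ?thesis
      using 1 2 3 by (simp add: S_def algebra_simps sum.distrib)
  qed
  finally show ?thesis by simp
qed

text \<open>Up to sign this is the sum of Ric(d e_k, f_k). Both parts of
  \<open>ricci_formula\<close> reduce to \<open>Q\<close>: the first has coefficient 2, and the
  second splits by the derivation rule into two copies of \<open>Q\<close>, so they cancel.\<close>

lemma ricci_derivation:
  assumes d: "linear d" and deriv: "\<And>x y. d (br x y) = br (d x) y + br x (d y)"
  shows "(\<Sum>k\<in>I. tr (\<lambda>z. D (D z (d (e k))) (f k))) = 0"
proof -
  define Q where "Q = (\<Sum>i\<in>I. \<Sum>j\<in>I. g (br (d (e i)) (e j)) (br (f i) (f j)))"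
  note d_simps = linear_add[OF d] linear_cmul[OF d]
  \<comment> \<open>Summing over \<open>k\<close> moves \<open>d\<close> from the basis onto a
    bracket, where the derivation rule applies.\<close>
  have inner: "(\<Sum>k\<in>I. g u (d (e k)) * g v (f k)) = g u (d v)" for u v
    using arg_cong[OF expand[of v], of "\<lambda>v. g (d v) u"]
    by (simp add: linear_sum[OF d] linear_cmul[OF d] sym[of u] g_sum_left g_simps mult.commute)
  have Q1: "(\<Sum>i\<in>I. \<Sum>j\<in>I. g (br (e i) (f j)) (br (d (f i)) (e j))) = Q"
  proof -
    have "(\<Sum>i\<in>I. \<Sum>j\<in>I. g (br (e i) (f j)) (br (d (f i)) (e j)))
        = (\<Sum>j\<in>I. \<Sum>i\<in>I. g (br (e i) (f j)) (br (d (f i)) (e j)))"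
      by (rule sum.swap)
    also have "\<dots> = (\<Sum>j\<in>I. \<Sum>i\<in>I. g (br (f i) (f j)) (br (d (e i)) (e j)))"
      by (intro sum.cong refl swap linearI) (simp_all add: d_simps br_simps g_simps)
    also have "\<dots> = Q"
      unfolding Q_def by (subst sum.swap) (simp add: sym)
    finally show ?thesis .
  qed
  have Q2: "(\<Sum>i\<in>I. \<Sum>j\<in>I. g (br (e i) (f j)) (br (f i) (d (e j)))) = Q"
  proof -
    have "g (br (e i) (f j)) (br (f i) (d (e j))) = g (br (f j) (e i)) (br (d (e j)) (f i))" for i j
      using br_skew[of "e i" "f j"] br_skew[of "f i" "d (e j)"] by (simp add: g_simps)
    then have "(\<Sum>i\<in>I. \<Sum>j\<in>I. g (br (e i) (f j)) (br (f i) (d (e j))))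
        = (\<Sum>i\<in>I. \<Sum>j\<in>I. g (br (f i) (e j)) (br (d (e i)) (f j)))"
      by simp (rule sum.swap)
    also have "\<dots> = (\<Sum>i\<in>I. \<Sum>j\<in>I. g (br (f i) (f j)) (br (d (e i)) (e j)))"
      by (intro sum.cong refl swap linearI) (simp_all add: d_simps br_simps g_simps)
    also have "\<dots> = Q"
      by (simp add: Q_def sym)
    finally show ?thesis .
  qed
  have "4 * (\<Sum>k\<in>I. tr (\<lambda>z. D (D z (d (e k))) (f k))) = 
    2 * Q - (\<Sum>k\<in>I. \<Sum>i\<in>I. \<Sum>j\<in>I. g (br (e i) (f j)) (d (e k)) * g (br (f i) (e j)) (f k))"
    by (simp add: sum_distrib_left ricci_formula sum_subtractf Q_def)
  also have "(\<Sum>k\<in>I. \<Sum>i\<in>I. \<Sum>j\<in>I. g (br (e i) (f j)) (d (e k)) * g (br (f i) (e j)) (f k))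
     = (\<Sum>i\<in>I. \<Sum>j\<in>I. \<Sum>k\<in>I. g (br (e i) (f j)) (d (e k)) * g (br (f i) (e j)) (f k))"
    by (subst sum.swap, rule sum.cong[OF refl], rule sum.swap)
  also have "\<dots> = (\<Sum>i\<in>I. \<Sum>j\<in>I. g (br (e i) (f j)) (d (br (f i) (e j))))"
    by (simp add: inner)
  also have "\<dots> = Q + Q"
    by (simp add: deriv g_simps sum.distrib Q1 Q2)
  finally show ?thesis by simp
qed

end

end

text \<open>Nondegeneracy represents each coordinate functional of \<open>B\<close> by a vector;
  these vectors form the dual family.\<close>

lemma finite_basis_dual:
  fixes g :: "'a::real_vector \<Rightarrow> 'a \<Rightarrow> real"
  assumes g: "pseudo_metric g" and B: "finite B" "independent B" "span B = (UNIV :: 'a set)"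
  shows "\<exists>f. dual_bases g (\<lambda>b. b) f B \<and> (\<forall>x. \<forall>b\<in>B. representation B x b = g x (f b))"
proof -
  have "linear (\<lambda>x. representation B x b)" for b
    using real_vector.linear_representation[OF B(2,3)]
    by (simp add: linear_def real_scaleR_def[abs_def])
  then have "\<exists>v. \<forall>x. g v x = representation B x b" for b
    using pseudo_metric_represents[OF g B(1,3)] by blast
  then obtain f where f: "\<And>b x. g (f b) x = representation B x b"
    by metis
  have sym: "g x y = g y x" for x y
    using g by (simp add: pseudo_metric_def)
  have rep: "representation B x b = g x (f b)" for x b
    using f sym by metis
  have "dual_bases g (\<lambda>b. b) f B"
  proof
    show "x = (\<Sum>b\<in>B. g x (f b) *\<^sub>R b)" for x
      using real_vector.sum_representation_eq[OF B(2) _ B(1) order_refl, of x] B(3)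
      by (simp add: rep)
  qed (use g B in auto)
  then show ?thesis
    using rep by blast
qed

lemma lin_trace_dual:
  assumes "dual_bases g (\<lambda>b. b) f B" "linear A" "finite B" "independent B" "span B = UNIV"
    "\<And>x b. b \<in> B \<Longrightarrow> representation B x b = g x (f b)"
  shows "lin_trace A = dual_bases.tr g (\<lambda>b. b) f B A"
  using assms by (simp add: lin_trace_eq[of A B] dual_bases.tr_def)

text \<open>The Einstein condition makes the Ricci tensor \<open>c * g x y\<close>. Putting
  \<open>x = d b\<close>, \<open>y = f b\<close> and summing over \<open>B\<close> gives
  \<open>c\<close> times the trace of \<open>d\<close>, which \<open>ricci_derivation\<close> shows
  to be zero.\<close>

lemma einstein_derivation_trace:
  fixes br :: "'a::real_vector \<Rightarrow> 'a \<Rightarrow> 'a"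
  assumes lie: "lie_bracket br" and g: "pseudo_metric g"
    and B: "finite B" "independent B" "span B = (UNIV :: 'a set)"
    and unimod: "\<And>x. lin_trace (br x) = 0"
    and killing: "\<And>x y. lin_trace (\<lambda>z. br x (br y z)) = 0"
    and d: "linear d" and deriv: "\<And>x y. d (br x y) = br (d x) y + br x (d y)"
    and ein: "\<And>x. ricci_operator br g x = c *\<^sub>R x"
  shows "c * lin_trace d = 0"
proof -
  obtain f where f: "dual_bases g (\<lambda>b. b) f B" "\<And>x b. b \<in> B \<Longrightarrow> representation B x b = g x (f b)"
    using finite_basis_dual[OF g B] by blast
  interpret dual_bases g "\<lambda>b. b" f B
    by (rule f(1))
  define D where "D = levi_civita br g"
  have LC: "is_levi_civita br g D"
    unfolding D_def levi_civita_def by (rule theI'[OF ex1_levi_civita[OF lie g B(1,3)]])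
  have bil: "bilinear br" "bilinear D"
    using lie LC by (auto simp: lie_bracket_def is_levi_civita_def)
  have tr: "lin_trace A = tr A" if "linear A" for A
    by (rule lin_trace_dual[OF f(1) that B f(2)])
  note simps = bilinear_ladd[OF bil(1)] bilinear_radd[OF bil(1)] bilinear_lmul[OF bil(1)]
    bilinear_rmul[OF bil(1)] bilinear_ladd[OF bil(2)] bilinear_radd[OF bil(2)]
    bilinear_lmul[OF bil(2)] bilinear_rmul[OF bil(2)]
  have t1: "tr (br x) = 0" for x
    using unimod[of x] tr[of "br x"] bil(1) by (simp add: bilinear_def)
  have t2: "tr (\<lambda>z. br x (br y z)) = 0" for x y
    using killing[of x y] by (subst (asm) tr) (auto intro!: linearI simp: simps)
  have ric: "c * g x y = - tr (\<lambda>z. D (D z x) y)" for x y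
  proof -
    have "c * g x y = ricci_tensor br g x y"
      using ricci_operator_spec[OF lie g B(1,3), of x y] ein[of x] by (simp add: g_simps)
    also have "\<dots> = tr (\<lambda>z. D z (D x y) - D x (D z y) - D (br z x) y)"
      unfolding ricci_tensor_def curvature_def Let_def D_def[symmetric]
      by (rule tr) (auto intro!: linearI simp: simps algebra_simps)
    finally show ?thesis
      using ricci_trace[OF lie t1 t2 LC] by simp
  qed
  have "c * lin_trace d = (\<Sum>b\<in>B. c * g (d b) (f b))"
    by (simp add: tr[OF d] tr_def sum_distrib_left)
  also have "\<dots> = 0"
    using ricci_derivation[OF lie t1 t2 LC d deriv] by (simp add: ric sum_negf)
  finally show ?thesis .
qed

subsection \<open>Nice diagrams with seven nodes\<close>

text \<open>
  Found by a computer search: the \<open>6894\<close> admissible sets of triples have \<open>541\<close> maximal elements,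
  and each of these is compatible with a weight vector of the list.
\<close>

definition weight_list :: "int list list" where
  "weight_list =
    [[-1,1,0,0,1,1,1], [0,0,0,0,0,1,1], [0,0,0,0,1,0,0], [0,0,1,0,1,1,1], [0,0,1,1,0,1,1],
     [0,1,0,0,1,1,1], [0,1,0,1,0,1,1], [0,1,0,1,1,1,1], [0,1,1,0,1,1,1], [0,1,1,2,2,3,3],
     [0,1,2,1,2,3,3], [0,2,0,2,1,1,2], [0,2,1,1,2,3,3], [1,-1,0,0,1,1,1], [1,0,0,0,1,1,1],
     [1,0,0,1,0,1,1], [1,0,0,1,1,1,1], [1,0,1,0,1,1,1], [1,0,1,2,2,3,3], [1,0,2,1,2,3,3],
     [1,1,1,1,2,2,2], [1,1,1,2,2,2,3], [1,1,1,2,2,3,3], [1,1,2,1,2,2,3], [1,1,2,1,2,3,3],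
     [1,1,2,2,2,3,3], [1,1,2,2,3,3,4], [1,1,2,2,3,4,3], [1,1,2,3,2,3,4], [1,1,2,3,3,4,4],
     [1,1,2,3,3,4,5], [1,2,0,1,2,3,3], [1,2,1,1,2,2,3], [1,2,1,1,2,3,3], [1,2,1,2,2,3,3],
     [1,2,1,2,3,3,4], [1,2,1,2,3,4,3], [1,2,2,1,2,3,3], [1,2,2,1,3,3,4], [1,2,2,3,3,4,5],
     [1,2,2,3,3,5,4], [1,2,2,3,4,3,5], [1,2,3,2,1,3,4], [1,2,3,2,3,4,5], [1,2,3,2,3,5,4],
     [1,2,3,2,4,3,5], [1,2,3,4,2,3,5], [1,2,3,4,4,5,6], [1,2,3,4,5,6,7], [1,2,3,4,5,7,6],
     [1,2,3,4,5,7,8], [1,2,3,4,6,5,7], [1,2,3,5,4,6,7], [1,2,3,5,6,7,8], [1,2,3,6,4,5,7],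
     [1,2,3,6,5,7,8], [1,2,4,3,4,5,6], [1,2,6,3,4,5,7], [1,2,6,3,5,7,8], [1,3,2,4,5,6,7],
     [1,3,4,2,5,6,7], [1,3,4,5,6,7,8], [1,3,4,5,6,7,9], [1,3,4,5,6,9,7], [1,4,2,3,4,5,6],
     [1,4,5,6,7,8,9], [1,6,2,3,4,5,7], [1,6,2,3,5,7,8], [2,0,0,2,1,1,2], [2,0,1,1,2,3,3],
     [2,1,0,1,2,3,3], [2,1,1,1,2,2,3], [2,1,1,1,2,3,3], [2,1,1,2,2,3,3], [2,1,1,2,3,3,4],
     [2,1,1,2,3,4,3], [2,1,2,1,2,3,3], [2,1,2,1,3,3,4], [2,1,2,3,3,4,5], [2,1,2,3,3,5,4],
     [2,1,2,3,4,3,5], [2,1,3,2,1,3,4], [2,1,3,2,3,4,5], [2,1,3,2,3,5,4], [2,1,3,2,4,3,5],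
     [2,1,3,4,2,3,5], [2,1,3,4,4,5,6], [2,1,3,4,5,6,7], [2,1,3,4,5,7,6], [2,1,3,4,5,7,8],
     [2,1,3,4,6,5,7], [2,1,3,5,4,6,7], [2,1,3,5,6,7,8], [2,1,3,6,4,5,7], [2,1,3,6,5,7,8],
     [2,1,4,3,4,5,6], [2,1,6,3,4,5,7], [2,1,6,3,5,7,8], [2,2,1,1,2,3,3], [2,2,1,1,3,3,4],
     [2,2,1,3,3,4,5], [2,2,1,3,3,5,4], [2,2,1,3,4,3,5], [2,3,1,4,5,6,7], [2,3,4,5,6,7,8],
     [2,3,4,5,6,8,7], [2,3,4,5,7,6,8], [2,3,4,6,5,7,8], [2,3,4,6,5,8,7], [2,3,4,6,7,8,10],
     [2,3,4,6,8,7,10], [2,3,4,7,6,8,10], [2,3,5,4,6,7,8], [2,3,5,4,6,8,7], [2,3,5,4,7,6,8],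
     [2,3,5,6,7,8,9], [2,3,5,6,7,9,8], [2,3,5,6,8,7,9], [2,3,5,7,6,8,9], [2,3,5,7,6,9,8],
     [2,3,5,7,8,9,11], [2,3,5,7,9,8,11], [2,3,5,8,7,9,11], [2,3,6,5,7,8,9], [2,3,6,5,7,9,8],
     [2,3,6,5,8,7,9], [2,4,1,3,4,5,6], [2,4,3,5,6,7,8], [2,4,3,5,6,8,7], [2,4,3,5,7,6,8],
     [2,4,3,6,5,7,8], [2,4,3,6,5,8,7], [2,4,3,6,7,8,10], [2,4,3,6,8,7,10], [2,4,3,7,6,8,10],
     [2,4,6,3,5,7,8], [2,4,6,3,5,8,7], [2,4,6,3,7,8,10], [2,4,6,3,8,7,10], [2,4,6,8,3,7,10],
     [2,6,1,3,4,5,7], [2,6,1,3,5,7,8], [2,6,3,5,7,8,9], [2,6,3,5,7,9,8], [2,6,3,5,8,7,9],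
     [3,1,2,4,5,6,7], [3,1,4,2,5,6,7], [3,1,4,5,6,7,8], [3,1,4,5,6,7,9], [3,1,4,5,6,9,7],
     [3,2,1,4,5,6,7], [3,2,2,1,3,4,5], [3,2,4,5,6,7,8], [3,2,4,5,6,8,7], [3,2,4,5,7,6,8],
     [3,2,4,6,5,7,8], [3,2,4,6,5,8,7], [3,2,4,6,7,8,10], [3,2,4,6,8,7,10], [3,2,4,7,6,8,10],
     [3,2,5,4,6,7,8], [3,2,5,4,6,8,7], [3,2,5,4,7,6,8], [3,2,5,6,7,8,9], [3,2,5,6,7,9,8],
     [3,2,5,6,8,7,9], [3,2,5,7,6,8,9], [3,2,5,7,6,9,8], [3,2,5,7,8,9,11], [3,2,5,7,9,8,11],
     [3,2,5,8,7,9,11], [3,2,6,5,7,8,9], [3,2,6,5,7,9,8], [3,2,6,5,8,7,9], [3,4,2,5,6,7,8],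
     [3,4,2,5,6,8,7], [3,4,2,5,7,6,8], [3,4,2,6,5,7,8], [3,4,2,6,5,8,7], [3,4,2,6,7,8,10],
     [3,4,2,6,8,7,10], [3,4,2,7,6,8,10], [3,4,7,2,6,8,10], [3,6,2,5,7,8,9], [3,6,2,5,7,9,8],
     [3,6,2,5,8,7,9], [4,1,1,2,3,4,5], [4,1,2,3,4,5,6], [4,1,5,6,7,8,9], [4,2,1,3,4,5,6],
     [4,2,3,5,6,7,8], [4,2,3,5,6,8,7], [4,2,3,5,7,6,8], [4,2,3,6,5,7,8], [4,2,3,6,5,8,7],
     [4,2,3,6,7,8,10], [4,2,3,6,8,7,10], [4,2,3,7,6,8,10], [4,2,6,3,5,7,8], [4,2,6,3,5,8,7],
     [4,2,6,3,7,8,10], [4,2,6,3,8,7,10], [4,2,6,8,3,7,10], [4,3,2,5,6,7,8], [4,3,2,5,6,8,7],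
     [4,3,2,5,7,6,8], [4,3,2,6,5,7,8], [4,3,2,6,5,8,7], [4,3,2,6,7,8,10], [4,3,2,6,8,7,10],
     [4,3,2,7,6,8,10], [4,3,7,2,6,8,10], [6,1,2,3,4,5,7], [6,1,2,3,5,7,8], [6,2,1,3,4,5,7],
     [6,2,1,3,5,7,8], [6,2,3,5,7,8,9], [6,2,3,5,7,9,8], [6,2,3,5,8,7,9], [6,3,2,5,7,8,9],
     [6,3,2,5,7,9,8], [6,3,2,5,8,7,9]]"

text \<open>Written out so that bounded quantifiers unfold into finite conjunctions or
  disjunctions.\<close>

definition triples :: "(nat \<times> nat \<times> nat) set" where
  "triples =
    {(0,1,2), (0,1,3), (0,1,4), (0,1,5), (0,1,6), (0,2,3), (0,2,4), (0,2,5), (0,2,6),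
     (0,3,4), (0,3,5), (0,3,6), (0,4,5), (0,4,6), (0,5,6), (1,2,3), (1,2,4), (1,2,5),
     (1,2,6), (1,3,4), (1,3,5), (1,3,6), (1,4,5), (1,4,6), (1,5,6), (2,3,4), (2,3,5),
     (2,3,6), (2,4,5), (2,4,6), (2,5,6), (3,4,5), (3,4,6), (3,5,6), (4,5,6)}"

lemma in_triples:
  assumes "i < j" "j < k" "k < 7"
  shows "(i, j, k) \<in> triples"
proof -
  have "k \<in> {0,1,2,3,4,5,6}" "j \<in> {0,1,2,3,4,5,6}" "i \<in> {0,1,2,3,4,5,6}"
    using assms by auto
  then show ?thesis
    using assms(1,2) unfolding triples_def by (elim insertE emptyE; hypsubst; simp)
qed

lemma weight_list_sum:
  "l \<in> set weight_list \<Longrightarrow> length l = 7 \<and> sum_list l \<noteq> 0"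
proof -
  have "\<forall>l\<in>set weight_list. length l = 7 \<and> sum_list l \<noteq> 0"
    by code_simp
  then show "l \<in> set weight_list \<Longrightarrow> length l = 7 \<and> sum_list l \<noteq> 0" by blast
qed

text \<open>
  \<open>B i j k\<close> stands for \<open>[e i, e j]\<close> being a nonzero multiple of \<open>e k\<close>; the last assumption says that
  a nonzero term in the coefficient of \<open>e t\<close> in a Jacobi identity must be cancelled by another one.
\<close>

lemma nice_diagram_weight:
  fixes B :: "nat \<Rightarrow> nat \<Rightarrow> nat \<Rightarrow> bool"
  assumes range: "\<And>i j k. B i j k \<Longrightarrow> i < k \<and> j < k \<and> k < 7"
    and sym: "\<And>i j k. B i j k \<longleftrightarrow> B j i k"
    and irrefl: "\<And>i k. \<not> B i i k"
    and func: "\<And>i j k l. B i j k \<Longrightarrow> B i j l \<Longrightarrow> k = l"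
    and inj: "\<And>i j k l. B i j l \<Longrightarrow> B i k l \<Longrightarrow> j = k"
    and jac: "\<And>a b c k t. B b c k \<Longrightarrow> B a k t \<Longrightarrow>
      (\<exists>l. B a c l \<and> B b l t) \<or> (\<exists>l. B a b l \<and> B c l t)"
  shows "\<exists>w::nat \<Rightarrow> int. (\<forall>i j k. B i j k \<longrightarrow> w i + w j = w k) \<and> (\<Sum>i<7. w i) \<noteq> 0"
proof (rule ccontr)
  assume no: "\<not> ?thesis"
  have sym': "B j i k = B i j k" if "i < j" for i j k
    using sym by blast
  have false: "B i j k = False" if "\<not> i < k \<or> \<not> j < k" for i j k
    using range that by blast
  \<comment> \<open>If no weight exists, each listed vector fails on some bracket, which yields one
    disjunction of atoms per vector.\<close>
  have W: "\<forall>l\<in>set weight_list. \<exists>(i, j, k)\<in>triples. B i j k \<and> l ! i + l ! j \<noteq> l ! k"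
  proof
    fix l assume l: "l \<in> set weight_list"
    then have "(\<Sum>i<7. l ! i) \<noteq> 0"
      using weight_list_sum[OF l] by (auto simp: sum_list_sum_nth atLeast0LessThan)
    then obtain i j k where ijk: "B i j k" "l ! i + l ! j \<noteq> l ! k"
      using no by blast
    then have "i < j \<or> j < i"
      using irrefl by (metis linorder_neqE_nat)
    then show "\<exists>(i, j, k)\<in>triples. B i j k \<and> l ! i + l ! j \<noteq> l ! k"
    proof
      assume "i < j"
      then show ?thesis using ijk range[OF ijk(1)] by (intro bexI[of _ "(i, j, k)"] in_triples) auto
    next
      assume "j < i"
      then show ?thesis using ijk range[OF ijk(1)] sym
        by (intro bexI[of _ "(j, i, k)"] in_triples) (auto simp: add.commute)
    qed
  qed


  define N :: "nat set" where "N = {0,1,2,3,4,5,6}"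
  have N: "k \<in> N" if "k < 7" for k
    using that by (auto simp: N_def)
  \<comment> \<open>With explicit indices up to 6, these rules send each atom \<open>B i j k\<close>
    to \<open>False\<close> or to an atom with \<open>i < j < k\<close>, so only 35 atoms
    survive.\<close>
  note [simp] = false irrefl sym'
  define N :: "nat set" where "N = {0,1,2,3,4,5,6}"
  have N: "k \<in> N" if "k < 7" for k
    using that by (auto simp: N_def)
  have "\<forall>(i, j, k)\<in>triples. \<forall>l\<in>N. k < l \<longrightarrow> \<not> (B i j k \<and> B i j l)"
    using func by force
  note func_clauses = this[unfolded triples_def N_def, simplified]
  have "\<forall>i\<in>N. \<forall>j\<in>N. \<forall>k\<in>N. j < k \<longrightarrow> (\<forall>l\<in>N. \<not> (B i j l \<and> B i k l))"
    using inj by force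
  note inj_clauses = this[unfolded N_def, simplified]
  \<comment> \<open>\<open>P a b c t\<close> encodes a nonzero \<open>e t\<close> component of
    \<open>[e a, [e b, e c]]\<close>.\<close>
  define P where "P a b c t \<longleftrightarrow> (\<exists>l\<in>N. B b c l \<and> B a l t)" for a b c t
  have P_sym: "P a b c t = P a c b t" for a b c t
    unfolding P_def by (intro bex_cong conj_cong refl sym)
  have P: "P b a c t \<or> P c a b t" if P: "P a b c t" for a b c t
  proof -
    obtain k where "B b c k" "B a k t"
      using P by (auto simp: P_def)
    then have "(\<exists>l. B a c l \<and> B b l t) \<or> (\<exists>l. B a b l \<and> B c l t)"
      by (rule jac)
    moreover have "l \<in> N" if "B x y l" for x y l
      using range[OF that] N by blast
    ultimately show ?thesis
      unfolding P_def by blast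
  qed
  \<comment> \<open>Here \<open>triples\<close> merely enumerates the three-element subsets of the
    indices; by \<open>P_sym\<close> one ordering \<open>a < b < c\<close> covers every Jacobi
    identity.\<close>
  have "\<forall>(a, b, c)\<in>triples. \<forall>t\<in>N. (P a b c t \<longrightarrow> P b a c t \<or> P c a b t) \<and>
      (P b a c t \<longrightarrow> P a b c t \<or> P c a b t) \<and> (P c a b t \<longrightarrow> P a b c t \<or> P b a c t)"
    using P P_sym by blast
  note jac_clauses = this[unfolded triples_def N_def P_def, simplified]
  note weight_clauses = W[unfolded weight_list_def triples_def, simplified]
  \<comment> \<open>All indices are now explicit, so what remains is the inconsistency of
    propositional formulas in the 35 atoms.\<close>
  show False
    using func_clauses inj_clauses jac_clauses weight_clauses by sat
qed

subsection \<open>Structure constants\<close>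

(* keeps {1..n} from being rewritten to {Suc 0..n} *)
declare One_nat_def [simp del]


locale lie_basis =
  fixes br :: "'a::real_vector \<Rightarrow> 'a \<Rightarrow> 'a" and n :: nat and b :: "nat \<Rightarrow> 'a"
  assumes lie: "lie_bracket br" and basis: "basis_family n b"
begin

abbreviation c :: "nat \<Rightarrow> nat \<Rightarrow> nat \<Rightarrow> real" where
  "c \<equiv> structure_const br n b"

definition coord :: "nat \<Rightarrow> 'a \<Rightarrow> real" where
  "coord i v = representation (b ` {1..n}) v (b i)"

lemma basis_set: "finite (b ` {1..n})" "independent (b ` {1..n})" "span (b ` {1..n}) = UNIV"
  and inj: "inj_on b {1..n}"
  using basis by (auto simp: basis_family_def)

lemma coord_br: "coord k (br (b i) (b j)) = c i j k"
  by (simp add: coord_def structure_const_def)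

lemma linear_coord: "linear (coord i)"
  using real_vector.linear_representation[OF basis_set(2,3)]
  by (simp add: linear_def real_scaleR_def[abs_def] coord_def[abs_def])

lemma coord_basis: "i \<in> {1..n} \<Longrightarrow> j \<in> {1..n} \<Longrightarrow> coord i (b j) = (if i = j then 1 else 0)"
  using inj by (auto simp: coord_def real_vector.representation_basis[OF basis_set(2)] dest: inj_onD)

lemma expand: "(\<Sum>i\<in>{1..n}. coord i v *\<^sub>R b i) = v"
proof -
  have "(\<Sum>x\<in>b ` {1..n}. representation (b ` {1..n}) v x *\<^sub>R x) = v"
    by (rule real_vector.sum_representation_eq) (use basis_set in auto)
  then show ?thesis
    by (simp add: sum.reindex[OF inj] coord_def)
qed

lemma linear_eq_zero:
  assumes "linear h" "\<And>i. i \<in> {1..n} \<Longrightarrow> h (b i) = 0"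
  shows "h x = 0"
proof -
  have "h (\<Sum>i\<in>{1..n}. coord i x *\<^sub>R b i) = 0"
    using assms by (simp add: linear_sum linear_cmul)
  then show ?thesis by (simp add: expand)
qed

lemma bilinear_eq_zero:
  assumes "\<And>x. linear (h x)" "\<And>y. linear (\<lambda>x. h x y)"
    and "\<And>i j. i \<in> {1..n} \<Longrightarrow> j \<in> {1..n} \<Longrightarrow> h (b i) (b j) = 0"
  shows "h x y = 0"
  using linear_eq_zero[OF assms(1)] linear_eq_zero[OF assms(2)] assms(3) by metis

lemma bilin: "bilinear br"
  and jacobi: "br x (br y z) + br y (br z x) + br z (br x y) = 0"
  using lie by (auto simp: lie_bracket_def)

lemmas br_simps = bilinear_ladd[OF bilin] bilinear_radd[OF bilin] bilinear_lmul[OF bilin]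
  bilinear_rmul[OF bilin]

lemma linear_br: "linear (br x)" "linear (\<lambda>x. br x y)"
  using bilin by (auto simp: bilinear_def)

lemmas skew = lie_bracket_skew[OF lie]

lemma c_skew: "c i j k = - c j i k"
  using skew[of "b i" "b j"] linear_neg[OF linear_coord]
  by (simp flip: coord_br)

lemma c_alt: "c i i k = 0"
  using c_skew[of i i k] by simp

lemma coord_br_br: "coord t (br (b i) (br (b j) (b k))) = (\<Sum>l\<in>{1..n}. c j k l * c i l t)"
proof -
  have "coord t (br (b i) (\<Sum>l\<in>{1..n}. c j k l *\<^sub>R b l)) = (\<Sum>l\<in>{1..n}. c j k l * c i l t)"
    by (simp add: linear_sum[OF linear_br(1)] linear_sum[OF linear_coord] br_simps
        linear_cmul[OF linear_coord] coord_br)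
  then show ?thesis by (simp add: expand flip: coord_br)
qed

lemma c_jacobi:
  "(\<Sum>l\<in>{1..n}. c j k l * c i l t) + (\<Sum>l\<in>{1..n}. c k i l * c j l t) + (\<Sum>l\<in>{1..n}. c i j l * c k l t) = 0"
  using arg_cong[OF jacobi[of "b i" "b j" "b k"], of "coord t"]
  by (simp add: linear_add[OF linear_coord] linear_0[OF linear_coord] coord_br_br)

lemma trace_eq: "linear h \<Longrightarrow> lin_trace h = (\<Sum>i\<in>{1..n}. coord i (h (b i)))"
  by (simp add: lin_trace_eq[OF _ basis_set] sum.reindex[OF inj] coord_def)

text \<open>Let \<open>d\<close> scale each \<open>b i\<close> by \<open>u i\<close>. The weight
  condition is the derivation rule on basis vectors, and the defect of the rule is bilinear, so it
  vanishes everywhere.\<close>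

lemma diagonal_derivation:
  assumes "\<forall>i\<in>{1..n}. \<forall>j\<in>{1..n}. \<forall>k\<in>{1..n}. c i j k \<noteq> 0 \<longrightarrow> u i + u j = u k"
  shows "\<exists>d. linear d \<and> (\<forall>x y. d (br x y) = br (d x) y + br x (d y)) \<and>
    lin_trace d = (\<Sum>i\<in>{1..n}. u i)"
proof (intro exI conjI allI)
  define d where "d v = (\<Sum>i\<in>{1..n}. (u i * coord i v) *\<^sub>R b i)" for v
  show lin: "linear d"
    by (rule linearI) (simp_all add: d_def linear_add[OF linear_coord] linear_cmul[OF linear_coord]
        algebra_simps sum.distrib scaleR_sum_right)
  have d_basis: "d (b i) = u i *\<^sub>R b i" if "i \<in> {1..n}" for i
  proof -
    have "d (b i) = (\<Sum>j\<in>{1..n}. if j = i then u i *\<^sub>R b i else 0)"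
      unfolding d_def using that by (intro sum.cong refl) (auto simp: coord_basis)
    then show ?thesis using that by (simp add: sum.delta)
  qed
  have on_basis: "d (br (b i) (b j)) = br (d (b i)) (b j) + br (b i) (d (b j))"
    if ij: "i \<in> {1..n}" "j \<in> {1..n}" for i j
  proof -
    have "d (br (b i) (b j)) = (\<Sum>k\<in>{1..n}. (u k * c i j k) *\<^sub>R b k)"
      by (simp add: d_def coord_br)
    also have "\<dots> = (\<Sum>k\<in>{1..n}. (u i + u j) *\<^sub>R (c i j k *\<^sub>R b k))"
      using assms ij by (intro sum.cong refl) auto
    also have "\<dots> = (u i + u j) *\<^sub>R br (b i) (b j)"
      using expand[of "br (b i) (b j)"] by (simp only: coord_br flip: scaleR_sum_right)
    finally show ?thesis
      by (simp add: d_basis[OF ij(1)] d_basis[OF ij(2)] br_simps algebra_simps)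
  qed
  show "d (br x y) = br (d x) y + br x (d y)" for x y
  proof -
    have "d (br x y) - (br (d x) y + br x (d y)) = 0"
      by (rule bilinear_eq_zero)
        (auto intro!: linearI simp: linear_add[OF lin] linear_cmul[OF lin] br_simps algebra_simps on_basis)
    then show ?thesis by simp
  qed
  show "lin_trace d = (\<Sum>i\<in>{1..n}. u i)"
    unfolding trace_eq[OF lin]
    by (intro sum.cong refl) (simp add: d_basis linear_cmul[OF linear_coord] coord_basis)
qed

end

section \<open>Nilpotent brackets in which basis vectors bracket to multiples of basis
  vectors\<close>

locale nilpotent_lie_basis = lie_basis +
  assumes nilpotent: "nilpotent_bracket br"
    and single: "\<And>i j k l. i \<in> {1..n} \<Longrightarrow> j \<in> {1..n} \<Longrightarrow> k \<in> {1..n} \<Longrightarrow> l \<in> {1..n} \<Longrightarrow>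
      c i j k \<noteq> 0 \<Longrightarrow> c i j l \<noteq> 0 \<Longrightarrow> k = l"
begin

lemma br_basis:
  assumes "i \<in> {1..n}" "j \<in> {1..n}" "k \<in> {1..n}" "c i j k \<noteq> 0"
  shows "br (b i) (b j) = c i j k *\<^sub>R b k"
proof -
  have other: "c i j l = 0" if "l \<in> {1..n}" "l \<noteq> k" for l
    using single[OF assms(1,2,3) that(1) assms(4)] that(2) by blast
  have "br (b i) (b j) = (\<Sum>l\<in>{1..n}. c i j l *\<^sub>R b l)"
    using expand[of "br (b i) (b j)"] by (simp add: coord_br)
  also have "\<dots> = (\<Sum>l\<in>{1..n}. if l = k then c i j k *\<^sub>R b k else 0)"
    by (intro sum.cong refl) (simp add: other)
  finally show ?thesis
    using assms by (simp add: sum.delta)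
qed

text \<open>The level of \<open>b i\<close> is the index of the deepest term of the lower central
  series containing it. A bracket with \<open>b j\<close> lies at least one term deeper, and
  \<open>b k\<close> is a multiple of it.\<close>

lemma ex_level:
  "\<exists>lev::nat \<Rightarrow> nat. \<forall>i\<in>{1..n}. \<forall>j\<in>{1..n}. \<forall>k\<in>{1..n}.
    c i j k \<noteq> 0 \<longrightarrow> lev i < lev k \<and> lev j < lev k"
proof -
  obtain K where K: "lower_central br K = {0}"
    using nilpotent by (auto simp: nilpotent_bracket_def)
  define M where "M i = {m. m \<le> K \<and> b i \<in> lower_central br m}" for i
  define lev where "lev i = Max (M i)" for i
  have fin: "finite (M i)" for i
    by (rule finite_subset[of _ "{..K}"]) (auto simp: M_def)
  have lev_in: "lev i \<in> M i" for i
    unfolding lev_def by (rule Max_in[OF fin]) (auto simp: M_def intro: exI[of _ 0])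
  have less: "lev j < lev k"
    if ijk: "i \<in> {1..n}" "j \<in> {1..n}" "k \<in> {1..n}" and nz: "c i j k \<noteq> 0" for i j k
  proof -
    have bj: "b j \<in> lower_central br (lev j)" "lev j \<le> K"
      using lev_in[of j] by (auto simp: M_def)
    have "b j \<noteq> 0"
      using ijk(2) basis_set(2) real_vector.dependent_zero by (metis image_eqI)
    then have "lev j \<noteq> K"
      using bj K by auto
    moreover have "br (b i) (b j) \<in> lower_central br (Suc (lev j))"
      using bj(1) by (auto intro: real_vector.span_base)
    then have "(1 / c i j k) *\<^sub>R (c i j k *\<^sub>R b k) \<in> lower_central br (Suc (lev j))"
      unfolding br_basis[OF ijk nz] lower_central.simps(2) by (rule real_vector.span_scale)
    then have "b k \<in> lower_central br (Suc (lev j))"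
      using nz by simp
    ultimately have "Suc (lev j) \<in> M k"
      using bj(2) by (simp add: M_def)
    then show ?thesis
      using Max_ge[OF fin[of k], of "Suc (lev j)"] by (simp add: lev_def)
  qed
  have "lev i < lev k \<and> lev j < lev k"
    if "i \<in> {1..n}" "j \<in> {1..n}" "k \<in> {1..n}" "c i j k \<noteq> 0" for i j k
    using less[of i j k] less[of j i k] that c_skew[of i j k] by auto
  then show ?thesis
    by blast
qed

lemma trace_ad: "lin_trace (br x) = 0"
proof -
  obtain lev :: "nat \<Rightarrow> nat" where lev: "\<forall>i\<in>{1..n}. \<forall>j\<in>{1..n}. \<forall>k\<in>{1..n}.
      c i j k \<noteq> 0 \<longrightarrow> lev i < lev k \<and> lev j < lev k"
    using ex_level by blast
  have zero: "c i j j = 0" if "i \<in> {1..n}" "j \<in> {1..n}" for i j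
    using lev that by fastforce
  have "linear (\<lambda>x. \<Sum>j\<in>{1..n}. coord j (br x (b j)))"
    by (rule linearI) (simp_all add: br_simps linear_add[OF linear_coord]
        linear_cmul[OF linear_coord] sum.distrib sum_distrib_left)
  moreover have "(\<Sum>j\<in>{1..n}. coord j (br (b i) (b j))) = 0" if "i \<in> {1..n}" for i
    by (intro sum.neutral ballI) (simp only: coord_br zero[OF that])
  ultimately have "(\<Sum>j\<in>{1..n}. coord j (br x (b j))) = 0"
    by (rule linear_eq_zero)
  then show ?thesis
    by (simp add: trace_eq[OF linear_br(1)])
qed

lemma trace_ad_ad: "lin_trace (\<lambda>z. br x (br y z)) = 0"
proof -
  obtain lev :: "nat \<Rightarrow> nat" where lev: "\<forall>i\<in>{1..n}. \<forall>j\<in>{1..n}. \<forall>k\<in>{1..n}.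
      c i j k \<noteq> 0 \<longrightarrow> lev i < lev k \<and> lev j < lev k"
    using ex_level by blast
  have zero: "c j k l * c i l k = 0" if "i \<in> {1..n}" "j \<in> {1..n}" "k \<in> {1..n}" "l \<in> {1..n}" for i j k l
  proof (rule ccontr)
    assume "\<not> ?thesis"
    then have "lev k < lev l" "lev l < lev k"
      using lev that by auto
    then show False by simp
  qed
  have "linear (\<lambda>y. \<Sum>k\<in>{1..n}. coord k (br x (br y (b k))))"
    and "linear (\<lambda>x. \<Sum>k\<in>{1..n}. coord k (br x (br y (b k))))" for x y
    by (rule linearI, simp_all add: br_simps linear_add[OF linear_coord]
        linear_cmul[OF linear_coord] sum.distrib sum_distrib_left)+
  moreover have "(\<Sum>k\<in>{1..n}. coord k (br (b i) (br (b j) (b k)))) = 0"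
    if "i \<in> {1..n}" "j \<in> {1..n}" for i j
    by (intro sum.neutral ballI) (simp only: coord_br_br zero[OF that] sum.neutral_const cong: sum.cong)
  ultimately have "(\<Sum>k\<in>{1..n}. coord k (br x (br y (b k)))) = 0"
    by (rule bilinear_eq_zero)
  moreover have "linear (\<lambda>z. br x (br y z))"
    by (rule linearI) (simp_all add: br_simps)
  ultimately show ?thesis
    by (simp add: trace_eq)
qed

end

lemma ex_sorting:
  fixes lev :: "nat \<Rightarrow> nat"
  shows "\<exists>s. bij_betw s {..<n} {1..n} \<and> (\<forall>i<n. \<forall>j<n. lev (s i) < lev (s j) \<longrightarrow> i < j)"
proof (intro exI conjI allI impI)
  define xs where "xs = sort_key lev [1..<Suc n]"
  have len: "length xs = n" and "distinct xs" and set: "set xs = {1..n}"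
    by (auto simp: xs_def)
  then show "bij_betw ((!) xs) {..<n} {1..n}"
    using bij_betw_nth by metis
  have "sorted (map lev xs)"
    by (simp add: xs_def)
  then have mono: "lev (xs ! j) \<le> lev (xs ! i)" if "j \<le> i" "i < n" for i j
    using sorted_nth_mono[of "map lev xs" j i] that len by simp
  show "i < j" if "i < n" "j < n" "lev (xs ! i) < lev (xs ! j)" for i j
    using mono[of j i] that by (meson leD leI)
qed

locale nice_nilpotent_lie_basis = nilpotent_lie_basis +
  assumes unique_partner: "\<And>i j k l. i \<in> {1..n} \<Longrightarrow> j \<in> {1..n} \<Longrightarrow> k \<in> {1..n} \<Longrightarrow> l \<in> {1..n} \<Longrightarrow>
      c i j k \<noteq> 0 \<Longrightarrow> c i l k \<noteq> 0 \<Longrightarrow> j = l"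
begin

lemma ex_weight:
  assumes "n = 7"
  shows "\<exists>u::nat \<Rightarrow> real. (\<Sum>i\<in>{1..n}. u i) \<noteq> 0 \<and>
    (\<forall>i\<in>{1..n}. \<forall>j\<in>{1..n}. \<forall>k\<in>{1..n}. c i j k \<noteq> 0 \<longrightarrow> u i + u j = u k)"
proof -
  obtain lev :: "nat \<Rightarrow> nat" where lev: "\<forall>i\<in>{1..n}. \<forall>j\<in>{1..n}. \<forall>k\<in>{1..n}.
      c i j k \<noteq> 0 \<longrightarrow> lev i < lev k \<and> lev j < lev k"
    using ex_level by blast
  obtain s where s: "bij_betw s {..<n} {1..n}"
    and mono: "\<forall>i<n. \<forall>j<n. lev (s i) < lev (s j) \<longrightarrow> i < j"
    using ex_sorting by blast
  have mem: "s i \<in> {1..n}" if "i < n" for i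
    using s that by (auto simp: bij_betw_def)
  have s_eq: "i = j" if "s i = s j" "i < n" "j < n" for i j
    using s that by (auto simp: bij_betw_def inj_on_def)
  have s_surj: "\<exists>l<n. s l = k" if "k \<in> {1..n}" for k
  proof -
    have "k \<in> s ` {..<n}"
      using s that by (simp add: bij_betw_def)
    then show ?thesis by auto
  qed
  define B where "B i j k \<longleftrightarrow> i < n \<and> j < n \<and> k < n \<and> c (s i) (s j) (s k) \<noteq> 0" for i j k
  have "\<exists>w::nat \<Rightarrow> int. (\<forall>i j k. B i j k \<longrightarrow> w i + w j = w k) \<and> (\<Sum>i<7. w i) \<noteq> 0"
  proof (rule nice_diagram_weight)
    show "i < k \<and> j < k \<and> k < 7" if "B i j k" for i j k
      using that lev[rule_format, of "s i" "s j" "s k"] mem mono assms by (simp add: B_def)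
    show "B i j k \<longleftrightarrow> B j i k" for i j k
      using c_skew[of "s i" "s j" "s k"] by (auto simp: B_def)
    show "\<not> B i i k" for i k
      by (simp add: B_def c_alt)
    show "k = l" if "B i j k" "B i j l" for i j k l
      using that single[of "s i" "s j" "s k" "s l"] mem s_eq[of k l] by (simp add: B_def)
    show "j = k" if "B i j l" "B i k l" for i j k l
      using that unique_partner[of "s i" "s j" "s l" "s k"] mem s_eq[of j k] by (simp add: B_def)
  next
    fix x y z k t
    assume B: "B y z k" "B x k t"
    then have mem': "s x \<in> {1..n}" "s y \<in> {1..n}" "s z \<in> {1..n}" "s k \<in> {1..n}" "c (s y) (s z) (s k) \<noteq> 0"
      using mem by (auto simp: B_def)
    have other: "c (s y) (s z) l = 0" if "l \<in> {1..n}" "l \<noteq> s k" for l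
      using single[OF mem'(2,3,4) that(1) mem'(5)] that(2) by blast
    let ?P = "\<lambda>x y z. \<Sum>l\<in>{1..n}. c (s y) (s z) l * c (s x) l (s t)"
    have "?P x y z = (\<Sum>l\<in>{1..n}. if l = s k then c (s y) (s z) (s k) * c (s x) (s k) (s t) else 0)"
      by (intro sum.cong refl) (simp add: other)
    also have "\<dots> \<noteq> 0"
      using B mem'(4) by (simp add: sum.delta B_def)
    finally have "?P y z x \<noteq> 0 \<or> ?P z x y \<noteq> 0"
      using c_jacobi[of "s y" "s z" "s x" "s t"] by auto
    moreover have "\<exists>l. B y' z' l \<and> B x' l t" if nz: "?P x' y' z' \<noteq> 0"
      and "x' < n" "y' < n" "z' < n" for x' y' z'
    proof -
      obtain l where l: "l \<in> {1..n}" "c (s y') (s z') l * c (s x') l (s t) \<noteq> 0"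
        using sum.not_neutral_contains_not_neutral[OF nz] by metis
      obtain m where "m < n" "s m = l"
        using s_surj[OF l(1)] by blast
      then show ?thesis
        using l(2) that B by (intro exI[of _ m]) (simp add: B_def)
    qed
    moreover have "x < n" "y < n" "z < n"
      using B by (auto simp: B_def)
    ultimately have "(\<exists>l. B z x l \<and> B y l t) \<or> (\<exists>l. B x y l \<and> B z l t)"
      by blast
    moreover have "B z x l \<longleftrightarrow> B x z l" for l
      using c_skew[of "s x" "s z" "s l"] by (auto simp: B_def)
    ultimately show "(\<exists>l. B x z l \<and> B y l t) \<or> (\<exists>l. B x y l \<and> B z l t)"
      by simp
  qed
  then obtain w :: "nat \<Rightarrow> int" where w: "\<And>i j k. B i j k \<Longrightarrow> w i + w j = w k" "(\<Sum>i<7. w i) \<noteq> 0"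
    by blast
  define u where "u k = real_of_int (w (inv_into {..<n} s k))" for k
  have inv: "inv_into {..<n} s k < n" "s (inv_into {..<n} s k) = k" if "k \<in> {1..n}" for k
    using s that inv_into_into[of k s "{..<n}"] f_inv_into_f[of k s "{..<n}"]
    by (auto simp: bij_betw_def)
  show ?thesis
  proof (intro exI conjI ballI impI)
    have "(\<Sum>i\<in>{1..n}. u i) = (\<Sum>i<n. real_of_int (w i))"
      by (subst sum.reindex_bij_betw[OF s, symmetric])
        (use s in \<open>auto intro!: sum.cong simp: u_def bij_betw_def inv_into_f_f\<close>)
    then show "(\<Sum>i\<in>{1..n}. u i) \<noteq> 0"
      using w(2) assms by (simp flip: of_int_sum)
    show "u i + u j = u k" if "i \<in> {1..n}" "j \<in> {1..n}" "k \<in> {1..n}" "c i j k \<noteq> 0" for i j k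
      using w(1)[of "inv_into {..<n} s i" "inv_into {..<n} s j" "inv_into {..<n} s k"] inv that
      by (simp add: B_def u_def flip: of_int_add)
  qed
qed

end

lemma nice_basis_locale:
  assumes "lie_bracket br" "nilpotent_bracket br" "nice_basis br n e"
  shows "nice_nilpotent_lie_basis br n e"
proof -
  interpret lie_basis br n e
    using assms by unfold_locales (auto simp: nice_basis_def)
  have lt: "k = l" if "i < j" "i \<in> {1..n}" "j \<in> {1..n}" "k \<in> {1..n}" "l \<in> {1..n}"
    "c i j k \<noteq> 0" "c i j l \<noteq> 0" for i j k l
    using assms(3) that unfolding nice_basis_def by blast
  have part: "{i, j} = {l, m} \<or> {i, j} \<inter> {l, m} = {}"
    if "i \<in> {1..n}" "j \<in> {1..n}" "l \<in> {1..n}" "m \<in> {1..n}" "k \<in> {1..n}"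
      "c i j k \<noteq> 0" "c l m k \<noteq> 0" for i j k l m
    using assms(3) that unfolding nice_basis_def by blast
  show ?thesis
  proof unfold_locales
    show "nilpotent_bracket br" by fact
    show "k = l" if "i \<in> {1..n}" "j \<in> {1..n}" "k \<in> {1..n}" "l \<in> {1..n}"
      "c i j k \<noteq> 0" "c i j l \<noteq> 0" for i j k l
      using lt[of i j k l] lt[of j i k l] that c_skew[of i j] c_alt[of i]
      by (metis linorder_neqE_nat neg_0_equal_iff_equal)
    show "j = l" if "i \<in> {1..n}" "j \<in> {1..n}" "k \<in> {1..n}" "l \<in> {1..n}"
      "c i j k \<noteq> 0" "c i l k \<noteq> 0" for i j k l
      using part[of i j i l k] that by (auto simp: doubleton_eq_iff)
  qed
qed

theorem theorem5p5:
  fixes br :: "'a::real_vector \<Rightarrow> 'a \<Rightarrow> 'a"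
  assumes "dim (UNIV :: 'a set) = 7"
    and "lie_bracket br"
    and "nilpotent_bracket br"
    and "\<exists>e. nice_basis br 7 e"
  shows "\<forall>g. pseudo_metric g \<and> einstein br g \<longrightarrow> ricci_flat br g"
proof (intro allI impI)
  fix g :: "'a \<Rightarrow> 'a \<Rightarrow> real"
  assume g: "pseudo_metric g \<and> einstein br g"
  then obtain c where c: "\<And>x. ricci_operator br g x = c *\<^sub>R x"
    by (auto simp: einstein_def)
  obtain e where "nice_basis br 7 e"
    using assms(4) by blast
  then interpret nice_nilpotent_lie_basis br 7 e
    by (rule nice_basis_locale[OF assms(2,3)])
  obtain u :: "nat \<Rightarrow> real" where sum: "(\<Sum>i\<in>{1..7}. u i) \<noteq> 0"
    and u: "\<forall>i\<in>{1..7}. \<forall>j\<in>{1..7}. \<forall>k\<in>{1..7}.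
      structure_const br 7 e i j k \<noteq> 0 \<longrightarrow> u i + u j = u k"
    using ex_weight by blast
  obtain d where d: "linear d" "\<And>x y. d (br x y) = br (d x) y + br x (d y)"
    "lin_trace d = (\<Sum>i\<in>{1..7}. u i)"
    using diagonal_derivation[OF u] by blast
  have "c * lin_trace d = 0"
    using einstein_derivation_trace[OF lie _ basis_set trace_ad trace_ad_ad d(1,2) c] g by blast
  then show "ricci_flat br g"
    using c d(3) sum by (simp add: ricci_flat_def)
qed

end
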